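(* Let $I\subset\mathbb{R}$ be a finite interval and let $G\colon\mathbb{R}^N\to[0,\infty)$ satisfy conditions $(G_1)$--$(G_6)$ listed in the context. Suppose that $\{u_n\}\subset\mathbf{L}^G(I,\mathbb{R}^N)$ and that 1. $u_n\to u$ a.e. on $I$; 2. there exists $h\in L^1(I,\mathbb{R})$ such that $G(u_n)\le h$ a.e. for every $n$. Then $u\in\mathbf{L}^G(I,\mathbb{R}^N)$ and $u_n\to u$ in $\mathbf{L}^G(I,\mathbb{R}^N)$.
   Context: Conditions on $G\colon\mathbb{R}^N\to[0,\infty)$: $(G_1)$ $G(0)=0$; $(G_2)$ $G$ is convex; $(G_3)$ $G$ is even; $(G_4)$ $\lim_{|x|\to\infty}G(x)/|x|=\infty$; $(G_5)$ ($\Delta_2$) there exist $K_1\ge 2$, $M_1>0$ with $G(2x)\le K_1G(x)$ for all $|x|\ge M_1$; $(G_6)$ ($\nabla_2$) there exist $K_2\ge1$, $M_2>0$ with $G(x)\le\frac{1}{2K_2}G(K_2x)$ for all $|x|\ge M_2$. Orlicz space: $\mathbf{L}^G(I,\mathbb{R}^N)$ is the set of measurable $u\colon I\to\mathbb{R}^N$ (identified when equal a.e.) with $\int_I G(u)\,dt<\infty$, with the Luxemburg norm $\|u\|_{\mathbf{L}^G}=\inf\{\alpha>0:\int_I G(u/\alpha)\,dt\le1\}$; convergence in $\mathbf{L}^G$ is convergence in this norm. *)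

theory Defs
  imports "HOL-Analysis.Analysis"
begin

definition Delta2 :: "('a::real_normed_vector \<Rightarrow> real) \<Rightarrow> bool" where
  "Delta2 G \<longleftrightarrow>
     (\<exists>K M. K \<ge> 2 \<and> M > 0 \<and> (\<forall>x. norm x \<ge> M \<longrightarrow> G (2 *\<^sub>R x) \<le> K * G x))"

definition Nabla2 :: "('a::real_normed_vector \<Rightarrow> real) \<Rightarrow> bool" where
  "Nabla2 G \<longleftrightarrow>
     (\<exists>K M. K \<ge> 1 \<and> M > 0 \<and> (\<forall>x. norm x \<ge> M \<longrightarrow> G x \<le> 1 / (2 * K) * G (K *\<^sub>R x)))"

text \<open>The codomain $[0,\infty)$ of \<open>G\<close> is rendered as nonnegativity of a real-valued function.\<close>

definition G_function :: "('a::real_normed_vector \<Rightarrow> real) \<Rightarrow> bool" where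
  "G_function G \<longleftrightarrow>
     (\<forall>x. 0 \<le> G x) \<and>
     G 0 = 0 \<and>
     convex_on UNIV G \<and>
     (\<forall>x. G (- x) = G x) \<and>
     filterlim (\<lambda>x. G x / norm x) at_top at_infinity \<and>
     Delta2 G \<and>
     Nabla2 G"

text \<open>
  Elements of the Orlicz space are represented by functions rather than by classes modulo
  almost everywhere equality; values outside \<open>I\<close> are irrelevant.  The integrals are Lebesgue
  integrals with values in $[0,\infty]$, so that a divergent integral counts as infinite
  (the Bochner integral would return \<open>0\<close>).
\<close>

definition Orlicz_space ::
    "real set \<Rightarrow> ('a::euclidean_space \<Rightarrow> real) \<Rightarrow> (real \<Rightarrow> 'a) set" where
  "Orlicz_space I G =
     {u \<in> borel_measurable (lebesgue_on I). (\<integral>\<^sup>+ t. ennreal (G (u t)) \<partial>lebesgue_on I) < \<infinity>}"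

text \<open>
  For convex \<open>G \<ge> 0\<close> with \<open>G 0 = 0\<close> the set below is nonempty whenever \<open>u\<close> is in the Orlicz
  space, since then \<open>G (u t / \<alpha>) \<le> G (u t) / \<alpha>\<close> for \<open>\<alpha> \<ge> 1\<close>; the infimum is thus a genuine one.
\<close>

definition Luxemburg_norm ::
    "real set \<Rightarrow> ('a::euclidean_space \<Rightarrow> real) \<Rightarrow> (real \<Rightarrow> 'a) \<Rightarrow> real" where
  "Luxemburg_norm I G u =
     Inf {\<alpha>. \<alpha> > 0 \<and> (\<integral>\<^sup>+ t. ennreal (G (u t /\<^sub>R \<alpha>)) \<partial>lebesgue_on I) \<le> 1}"

end

theory Submission
  imports Defs
begin

text \<open>
  The theorem is dominated convergence for the modular \<open>u \<mapsto> \<integral> G (u t) dt\<close>, transferred to the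
  Luxemburg norm by means of the \<open>\<Delta>\<^sub>2\<close> condition.

  By the definition of the norm as an infimum, \<open>\<integral> G ((us n t - u t) / e) dt \<le> 1\<close> already implies
  that \<open>us n - u\<close> has norm at most \<open>e\<close>.  It therefore suffices that this integral tends to \<open>0\<close> for
  every fixed \<open>e > 0\<close>.  The integrand tends to \<open>0\<close> almost everywhere, because a finite convex
  function on a Euclidean space is continuous and \<open>G 0 = 0\<close>.  For an integrable majorant, convexity
  and evenness bound the integrand by the mean of \<open>G ((2/e) us n)\<close> and \<open>G ((2/e) u)\<close>, and \<open>\<Delta>\<^sub>2\<close> gives
  constants with \<open>G (c x) \<le> A G x + B\<close> for all \<open>x\<close> (lemma \<open>Delta2_imp_scaling_bound\<close>).
  Since \<open>G (us n) \<le> h\<close>, and in the limit also \<open>G u \<le> h\<close>, the majorant is \<open>A h + B\<close>; the constant \<open>B\<close>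
  is integrable because \<open>I\<close> is bounded.
\<close>

lemma Delta2_imp_doubling_bound:
  fixes G :: "'a::euclidean_space \<Rightarrow> real"
  assumes D: "Delta2 G" and cont: "continuous_on UNIV G" and nonneg: "\<And>x. 0 \<le> G x"
  obtains A B where "A \<ge> 0" "B \<ge> 0" "\<And>x. G (2 *\<^sub>R x) \<le> A * G x + B"
proof -
  obtain K M where K: "K \<ge> 2" and M: "\<And>x. norm x \<ge> M \<Longrightarrow> G (2 *\<^sub>R x) \<le> K * G x"
    using D unfolding Delta2_def by blast
  have "compact ((\<lambda>x. G (2 *\<^sub>R x)) ` cball 0 M)"
    by (intro compact_continuous_image continuous_on_compose2[OF cont] continuous_intros) auto
  then obtain C where C: "\<And>x. x \<in> cball 0 M \<Longrightarrow> \<bar>G (2 *\<^sub>R x)\<bar> \<le> C"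
    by (force dest!: compact_imp_bounded simp: bounded_iff)
  have "G (2 *\<^sub>R x) \<le> K * G x + \<bar>C\<bar>" for x
  proof (cases "norm x \<ge> M")
    case True
    then show ?thesis using M[of x] by linarith
  next
    case False
    moreover have "0 \<le> K * G x" using K nonneg[of x] by simp
    ultimately show ?thesis using C[of x] by simp
  qed
  then show ?thesis using K by (intro that[of K "\<bar>C\<bar>"]) auto
qed

lemma Delta2_imp_scaling_bound:
  fixes G :: "'a::euclidean_space \<Rightarrow> real"
  assumes D: "Delta2 G" and conv: "convex_on UNIV G" and nonneg: "\<And>x. 0 \<le> G x"
    and zero: "G 0 = 0" and c: "0 \<le> c"
  obtains A B where "A \<ge> 0" "B \<ge> 0" "\<And>x. G (c *\<^sub>R x) \<le> A * G x + B"
proof -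
  have cont: "continuous_on UNIV G"
    using conv by (intro convex_on_continuous) auto
  obtain A B where A: "A \<ge> 0" and B: "B \<ge> 0" and AB: "\<And>x. G (2 *\<^sub>R x) \<le> A * G x + B"
    using Delta2_imp_doubling_bound[OF D cont nonneg] by blast
  have pow: "\<exists>A' B'. A' \<ge> 0 \<and> B' \<ge> 0 \<and> (\<forall>x. G (2 ^ k *\<^sub>R x) \<le> A' * G x + B')" for k
  proof (induction k)
    case 0
    show ?case by (rule exI[of _ 1], rule exI[of _ 0]) simp
  next
    case (Suc k)
    then obtain A' B' where *: "A' \<ge> 0" "B' \<ge> 0" "\<And>x. G (2 ^ k *\<^sub>R x) \<le> A' * G x + B'"
      by blast
    have "G (2 ^ Suc k *\<^sub>R x) \<le> (A * A') * G x + (A * B' + B)" for x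
    proof -
      have "G (2 ^ Suc k *\<^sub>R x) \<le> A * G (2 ^ k *\<^sub>R x) + B"
        using AB[of "2 ^ k *\<^sub>R x"] by simp
      also have "\<dots> \<le> A * (A' * G x + B') + B"
        using *(3)[of x] A by (intro add_right_mono mult_left_mono)
      finally show ?thesis by (simp add: algebra_simps)
    qed
    then show ?case using A B * by (intro exI[of _ "A * A'"] exI[of _ "A * B' + B"]) auto
  qed
  obtain k where k: "c < 2 ^ k"
    using real_arch_pow[of 2 c] by auto
  obtain A' B' where *: "A' \<ge> 0" "B' \<ge> 0" "\<And>x. G (2 ^ k *\<^sub>R x) \<le> A' * G x + B'"
    using pow by blast
  have "G (c *\<^sub>R x) \<le> A' * G x + B'" for x
  proof -
    define s where "s = c / 2 ^ k"
    have s: "0 \<le> s" "s \<le> 1" using k c by (auto simp: s_def divide_simps)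
    \<comment> \<open>\<open>c x\<close> lies on the segment from \<open>0\<close> to \<open>2\<^sup>k x\<close>, where \<open>G\<close> is largest at the far end.\<close>
    have "G (c *\<^sub>R x) = G ((1 - s) *\<^sub>R 0 + s *\<^sub>R (2 ^ k *\<^sub>R x))"
      by (simp add: s_def)
    also have "\<dots> \<le> (1 - s) * G 0 + s * G (2 ^ k *\<^sub>R x)"
      using s by (intro convex_onD[OF conv]) auto
    also have "\<dots> \<le> G (2 ^ k *\<^sub>R x)"
      using s nonneg[of "2 ^ k *\<^sub>R x"] zero by (simp add: mult_left_le_one_le)
    finally show ?thesis using *(3)[of x] by linarith
  qed
  then show ?thesis using that * by blast
qed

text \<open>
  Completeness of Lebesgue measure is what makes a limit that exists only almost everywhere
  measurable: the values of \<open>g\<close> on the exceptional null set are arbitrary.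
\<close>

lemma borel_measurable_lebesgue_on_AE_LIMSEQ:
  fixes f :: "nat \<Rightarrow> 'a::euclidean_space \<Rightarrow> 'b::euclidean_space"
  assumes S: "S \<in> sets lebesgue" and f: "\<And>n. f n \<in> borel_measurable (lebesgue_on S)"
    and lim: "AE x in lebesgue_on S. (\<lambda>n. f n x) \<longlonglongrightarrow> g x"
  shows "g \<in> borel_measurable (lebesgue_on S)"
proof -
  obtain N where N: "N \<in> null_sets (lebesgue_on S)"
    and sub: "{x \<in> space (lebesgue_on S). \<not> (\<lambda>n. f n x) \<longlonglongrightarrow> g x} \<subseteq> N"
    using lim unfolding eventually_ae_filter by blast
  have "g \<in> borel_measurable (lebesgue_on (S - N))"
  proof (rule borel_measurable_LIMSEQ_metric)
    show "f n \<in> borel_measurable (lebesgue_on (S - N))" for n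
      using f borel_measurable_diff_null[OF N S] by blast
    show "(\<lambda>n. f n x) \<longlonglongrightarrow> g x" if "x \<in> space (lebesgue_on (S - N))" for x
      using that sub by auto
  qed
  then show ?thesis using borel_measurable_diff_null[OF N S] by blast
qed

lemma Luxemburg_norm_le:
  assumes "e > 0" and "(\<integral>\<^sup>+ t. ennreal (G (v t /\<^sub>R e)) \<partial>lebesgue_on I) \<le> 1"
  shows "Luxemburg_norm I G v \<le> e" and "0 \<le> Luxemburg_norm I G v"
proof -
  let ?S = "{\<alpha>. \<alpha> > 0 \<and> (\<integral>\<^sup>+ t. ennreal (G (v t /\<^sub>R \<alpha>)) \<partial>lebesgue_on I) \<le> 1}"
  have e: "e \<in> ?S" using assms by simp
  show "Luxemburg_norm I G v \<le> e"
    unfolding Luxemburg_norm_def using e by (intro cInf_lower bdd_belowI[of _ 0]) auto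
  \<comment> \<open>The infimum over the empty set is unspecified, so \<open>e \<in> ?S\<close> is needed here too.\<close>
  show "0 \<le> Luxemburg_norm I G v"
    unfolding Luxemburg_norm_def using e by (intro cInf_greatest) auto
qed

lemma tendsto_Luxemburg_norm_0:
  assumes "\<And>e. e > 0 \<Longrightarrow>
    (\<lambda>n. \<integral>\<^sup>+ t. ennreal (G (v n t /\<^sub>R e)) \<partial>lebesgue_on I) \<longlonglongrightarrow> 0"
  shows "(\<lambda>n. Luxemburg_norm I G (v n)) \<longlonglongrightarrow> 0"
proof (rule tendstoI)
  fix r :: real assume r: "r > 0"
  then have r2: "r / 2 > 0" by simp
  then have "\<forall>\<^sub>F n in sequentially. (\<integral>\<^sup>+ t. ennreal (G (v n t /\<^sub>R (r / 2))) \<partial>lebesgue_on I) < 1"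
    using order_tendstoD(2)[OF assms[OF r2], of 1] by simp
  then show "\<forall>\<^sub>F n in sequentially. dist (Luxemburg_norm I G (v n)) 0 < r"
  proof eventually_elim
    case (elim n)
    have "Luxemburg_norm I G (v n) \<le> r / 2" "0 \<le> Luxemburg_norm I G (v n)"
      using r2 less_imp_le[OF elim] Luxemburg_norm_le[of "r / 2" I G "v n"] by blast+
    then show ?case using r by (simp add: dist_real_def)
  qed
qed

lemma Delta2_modular_diff_tendsto_0:
  fixes G :: "'a::euclidean_space \<Rightarrow> real" and us :: "nat \<Rightarrow> 'b \<Rightarrow> 'a"
  assumes fin: "finite_measure M"
    and D: "Delta2 G" and conv: "convex_on UNIV G" and nonneg: "\<And>x. 0 \<le> G x"
    and zero: "G 0 = 0" and even: "\<And>x. G (- x) = G x"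
    and us [measurable]: "\<And>n. us n \<in> borel_measurable M"
    and u [measurable]: "u \<in> borel_measurable M"
    and lim: "AE t in M. (\<lambda>n. us n t) \<longlonglongrightarrow> u t"
    and h: "integrable M h"
    and us_le: "\<And>n. AE t in M. G (us n t) \<le> h t" and u_le: "AE t in M. G (u t) \<le> h t"
    and e: "e > 0"
  shows "(\<lambda>n. \<integral>\<^sup>+ t. ennreal (G ((us n t - u t) /\<^sub>R e)) \<partial>M) \<longlonglongrightarrow> 0"
proof -
  interpret finite_measure M by fact
  have cont: "continuous_on UNIV G"
    using conv by (intro convex_on_continuous) auto
  then have [measurable]: "G \<in> borel_measurable borel"
    by (rule borel_measurable_continuous_onI)
  obtain A B where A: "A \<ge> 0" and B: "B \<ge> 0"
    and AB: "\<And>x. G ((2 / e) *\<^sub>R x) \<le> A * G x + B"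
    using Delta2_imp_scaling_bound[OF D conv nonneg zero, of "2 / e"] e by auto
  have diff_le: "G ((x - y) /\<^sub>R e) \<le> A * b + B" if x: "G x \<le> b" and y: "G y \<le> b" for x y b
  proof -
    have "(x - y) /\<^sub>R e = (1 - 1/2) *\<^sub>R ((2 / e) *\<^sub>R x) + (1/2) *\<^sub>R (- ((2 / e) *\<^sub>R y))"
      by (simp add: scaleR_diff_right inverse_eq_divide)
    then have "G ((x - y) /\<^sub>R e)
        \<le> (1 - 1/2) * G ((2 / e) *\<^sub>R x) + (1/2) * G (- ((2 / e) *\<^sub>R y))"
      using convex_onD[OF conv, of "1/2" "(2 / e) *\<^sub>R x" "- ((2 / e) *\<^sub>R y)"] by simp
    also have "\<dots> = (G ((2 / e) *\<^sub>R x) + G ((2 / e) *\<^sub>R y)) / 2"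
      by (simp add: even)
    also have "\<dots> \<le> ((A * b + B) + (A * b + B)) / 2"
    proof (intro divide_right_mono add_mono)
      show "G ((2 / e) *\<^sub>R x) \<le> A * b + B"
        using AB[of x] mult_left_mono[OF x A] by linarith
      show "G ((2 / e) *\<^sub>R y) \<le> A * b + B"
        using AB[of y] mult_left_mono[OF y A] by linarith
    qed simp
    finally show ?thesis by simp
  qed
  have "(\<lambda>n. \<integral>\<^sup>+ t. ennreal (G ((us n t - u t) /\<^sub>R e)) \<partial>M) \<longlonglongrightarrow> (\<integral>\<^sup>+ t. 0 \<partial>M)"
  proof (rule nn_integral_dominated_convergence[where w = "\<lambda>t. ennreal (A * h t + B)"])
    show "AE t in M. ennreal (G ((us n t - u t) /\<^sub>R e)) \<le> ennreal (A * h t + B)" for n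
      using us_le[of n] u_le by eventually_elim (intro ennreal_leI diff_le)
    have int: "integrable M (\<lambda>t. A * h t + B)" using h by simp
    have "AE t in M. 0 \<le> A * h t + B"
      using u_le
    proof eventually_elim
      case (elim t)
      then have "0 \<le> h t" using nonneg[of "u t"] by linarith
      then show ?case using A B by simp
    qed
    then show "(\<integral>\<^sup>+ t. ennreal (A * h t + B) \<partial>M) < \<infinity>"
      using nn_integral_eq_integral[OF int] by simp
    show "(\<lambda>t. ennreal (A * h t + B)) \<in> borel_measurable M"
      using int by measurable
    show "AE t in M. (\<lambda>n. ennreal (G ((us n t - u t) /\<^sub>R e))) \<longlonglongrightarrow> 0"
      using lim
    proof eventually_elim
      case (elim t)
      then have "(\<lambda>n. (us n t - u t) /\<^sub>R e) \<longlonglongrightarrow> (u t - u t) /\<^sub>R e"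
        by (intro tendsto_intros)
      then have "(\<lambda>n. G ((us n t - u t) /\<^sub>R e)) \<longlonglongrightarrow> G ((u t - u t) /\<^sub>R e)"
        by (rule continuous_on_tendsto_compose[OF cont]) auto
      then have "(\<lambda>n. G ((us n t - u t) /\<^sub>R e)) \<longlonglongrightarrow> 0"
        by (simp add: zero)
      then show ?case
        using tendsto_ennrealI by (metis ennreal_0)
    qed
  qed measurable
  then show ?thesis by simp
qed

theorem theorem3p14:
  fixes I :: "real set"
    and G :: "real ^ 'n \<Rightarrow> real"
    and u :: "real \<Rightarrow> real ^ 'n"
    and us :: "nat \<Rightarrow> real \<Rightarrow> real ^ 'n"
    and h :: "real \<Rightarrow> real"
  assumes "is_interval I" and "bounded I"
    and "G_function G"
    and "\<And>n. us n \<in> Orlicz_space I G"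
    and "AE t in lebesgue_on I. (\<lambda>n. us n t) \<longlonglongrightarrow> u t"
    and "integrable (lebesgue_on I) h"
    and "\<And>n. AE t in lebesgue_on I. G (us n t) \<le> h t"
  shows "u \<in> Orlicz_space I G \<and>
    (\<lambda>n. Luxemburg_norm I G (\<lambda>t. us n t - u t)) \<longlonglongrightarrow> 0"
proof -
  have nonneg: "\<And>x. 0 \<le> G x" and zero: "G 0 = 0" and conv: "convex_on UNIV G"
    and even: "\<And>x. G (- x) = G x" and D: "Delta2 G"
    using assms(3) unfolding G_function_def by auto
  have I: "I \<in> lmeasurable"
    using assms(1,2) by (intro measurable_convex is_interval_convex)
  have us: "us n \<in> borel_measurable (lebesgue_on I)" for n
    using assms(4)[of n] by (simp add: Orlicz_space_def)
  have u: "u \<in> borel_measurable (lebesgue_on I)"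
    using borel_measurable_lebesgue_on_AE_LIMSEQ[OF _ us assms(5)] I by blast
  have cont: "continuous_on UNIV G"
    using conv by (intro convex_on_continuous) auto
  have "AE t in lebesgue_on I. \<forall>n. G (us n t) \<le> h t"
    using assms(7) by (simp add: AE_all_countable)
  with assms(5) have u_le: "AE t in lebesgue_on I. G (u t) \<le> h t"
  proof eventually_elim
    case (elim t)
    have "(\<lambda>n. G (us n t)) \<longlonglongrightarrow> G (u t)"
      using elim(1) by (rule continuous_on_tendsto_compose[OF cont]) auto
    then show ?case using elim(2) by (intro LIMSEQ_le_const2) auto
  qed
  have "(\<integral>\<^sup>+ t. ennreal (G (u t)) \<partial>lebesgue_on I) \<le> (\<integral>\<^sup>+ t. ennreal (h t) \<partial>lebesgue_on I)"
    using u_le by (intro nn_integral_mono_AE) (auto elim!: eventually_mono intro: ennreal_leI)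
  also have "\<dots> \<le> (\<integral>\<^sup>+ t. ennreal (norm (h t)) \<partial>lebesgue_on I)"
    by (intro nn_integral_mono ennreal_leI) simp
  also have "\<dots> < \<infinity>"
    using assms(6) by (simp add: integrable_iff_bounded)
  finally have "u \<in> Orlicz_space I G"
    using u by (simp add: Orlicz_space_def)
  moreover have "(\<lambda>n. Luxemburg_norm I G (\<lambda>t. us n t - u t)) \<longlonglongrightarrow> 0"
  proof (rule tendsto_Luxemburg_norm_0)
    fix e :: real assume "e > 0"
    then show "(\<lambda>n. \<integral>\<^sup>+ t. ennreal (G ((us n t - u t) /\<^sub>R e)) \<partial>lebesgue_on I) \<longlonglongrightarrow> 0"
      by (rule Delta2_modular_diff_tendsto_0[OF finite_measure_lebesgue_on[OF I] D conv nonneg zero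
            even us u assms(5,6,7) u_le])
  qed
  ultimately show ?thesis ..
qed

end
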